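(* Let $\mu$ be a metric on the set $\mathcal{R}$ of all regions of $\mathbb{E}^n$ such that the topology $\mathbb{T}_\mu$ generated by $\mu$ is well-behaved. Then, restricted to the set $\mathcal{C}\subset\mathcal{R}$ of convex regions, $\mathbb{T}_\mu$ is equal to $\mathbb{T}_H$, the topology generated by the Hausdorff metric $H$.
   Context: Fix $n\ge 2$; $\mathbb{E}^n$ is $n$-dimensional Euclidean space with distance $d$. A region is a nonempty bounded open subset of $\mathbb{E}^n$ equal to the interior of its closure; $\mathcal{R}$ is the set of all regions and $\mathcal{C}$ the set of all convex regions. For a point $p$ and region $Q$, $d(p,Q)=\min_{q\in\bar Q}d(p,q)$. $H^1(P,Q)=\sup_{p\in P}d(p,Q)$ and $H(P,Q)=\max(H^1(P,Q),H^1(Q,P))$ is the Hausdorff metric. A history is a function $\phi:[0,1]\to\mathcal{R}$. A morphing is a uniformly continuous function $\psi:[0,1]\times\mathbb{E}^n\to\mathbb{E}^n$ such that $\psi(0,\cdot)$ is the identity and, for each $t\in[0,1]$, $\psi(t,\cdot)$ is a homeomorphism of $\mathbb{E}^n$ to itself. A history $\phi$ corresponds to the morphing $\psi$ if $\phi(t)=\psi(t,\phi(0))$ (image set) for all $t$. A topology $\mathbb{T}$ on $\mathcal{R}$ supports continuous morphing if every history that corresponds to a morphing is continuous relative to $\mathbb{T}$. A topology $\mathbb{T}$ on $\mathcal{R}$ satisfies the region separation condition if for all $P,Z\in\mathcal{R}$: (i) if $P\cap Z=\emptyset$ then there is a $\mathbb{T}$-neighborhood $\mathcal{U}$ of $P$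 such that no superset of $Z$ is in $\mathcal{U}$; (ii) if $P\supset Z$ then there is a $\mathbb{T}$-neighborhood $\mathcal{U}$ of $P$ such that no region disjoint from $Z$ is in $\mathcal{U}$. A topology is well-behaved if it supports continuous morphing and satisfies the region separation condition. *)

theory Defs
  imports "HOL-Analysis.Analysis"
begin

definition regions :: "'a::euclidean_space set set" where
  "regions = {Q. Q \<noteq> {} \<and> bounded Q \<and> open Q \<and> Q = interior (closure Q)}"

definition convex_regions :: "'a::euclidean_space set set" where
  "convex_regions = {Q \<in> regions. convex Q}"

text \<open>For a region \<open>Q\<close> the infimum in \<^term>\<open>infdist p (closure Q)\<close> is a minimum,
  since the closure is compact and nonempty.\<close>

definition hausdorff1 :: "'a::euclidean_space set \<Rightarrow> 'a set \<Rightarrow> real" where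
  "hausdorff1 P Q = (SUP p\<in>P. infdist p (closure Q))"

text \<open>The locale \<^locale>\<open>Metric_space\<close> requires nonnegativity also outside the carrier, where
  the supremum may be unspecified; hence the value 0 there. Topologies on \<^term>\<open>regions\<close>
  do not depend on this choice.\<close>

definition hausdorff_dist :: "'a::euclidean_space set \<Rightarrow> 'a set \<Rightarrow> real" where
  "hausdorff_dist P Q =
     (if P \<in> regions \<and> Q \<in> regions then max (hausdorff1 P Q) (hausdorff1 Q P) else 0)"

text \<open>Only the values of a history and of a morphing at times in \<open>[0,1]\<close> are constrained
  or used.\<close>

definition history :: "(real \<Rightarrow> 'a::euclidean_space set) \<Rightarrow> bool" where
  "history \<phi> \<longleftrightarrow> (\<forall>t\<in>{0..1}. \<phi> t \<in> regions)"

definition morphing :: "(real \<Rightarrow> 'a::euclidean_space \<Rightarrow> 'a) \<Rightarrow> bool" where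
  "morphing \<psi> \<longleftrightarrow>
     uniformly_continuous_on ({0..1} \<times> UNIV) (\<lambda>(t, x). \<psi> t x) \<and>
     (\<forall>x. \<psi> 0 x = x) \<and>
     (\<forall>t\<in>{0..1}. \<exists>g. homeomorphism UNIV UNIV (\<psi> t) g)"

definition corresponds ::
    "(real \<Rightarrow> 'a::euclidean_space set) \<Rightarrow> (real \<Rightarrow> 'a \<Rightarrow> 'a) \<Rightarrow> bool" where
  "corresponds \<phi> \<psi> \<longleftrightarrow> (\<forall>t\<in>{0..1}. \<phi> t = \<psi> t ` \<phi> 0)"

definition supports_continuous_morphing :: "'a::euclidean_space set topology \<Rightarrow> bool" where
  "supports_continuous_morphing T \<longleftrightarrow>
     (\<forall>\<phi> \<psi>. history \<phi> \<and> morphing \<psi> \<and> corresponds \<phi> \<psi> \<longrightarrow>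
        continuous_map (top_of_set {0..1}) T \<phi>)"

definition neighbourhood_in :: "'b topology \<Rightarrow> 'b \<Rightarrow> 'b set \<Rightarrow> bool" where
  "neighbourhood_in T x U \<longleftrightarrow> U \<subseteq> topspace T \<and> (\<exists>V. openin T V \<and> x \<in> V \<and> V \<subseteq> U)"

definition region_separation :: "'a::euclidean_space set topology \<Rightarrow> bool" where
  "region_separation T \<longleftrightarrow>
     (\<forall>P\<in>regions. \<forall>Z\<in>regions.
        (P \<inter> Z = {} \<longrightarrow> (\<exists>U. neighbourhood_in T P U \<and> \<not> (\<exists>Q\<in>U. Z \<subseteq> Q))) \<and>
        (Z \<subseteq> P \<longrightarrow> (\<exists>U. neighbourhood_in T P U \<and> \<not> (\<exists>Q\<in>U. Q \<inter> Z = {}))))"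

definition well_behaved :: "'a::euclidean_space set topology \<Rightarrow> bool" where
  "well_behaved T \<longleftrightarrow> supports_continuous_morphing T \<and> region_separation T"

lemma infdist_le_hausdorff1:
  fixes P Q :: "'a::euclidean_space set"
  assumes "P \<in> regions" "Q \<in> regions" "p \<in> closure P"
  shows "infdist p (closure Q) \<le> hausdorff1 P Q"
proof -
  have "continuous_on (closure P) (\<lambda>x. infdist x (closure Q))"
    by (intro continuous_intros)
  moreover have "compact (closure P)"
    using assms by (simp add: regions_def)
  ultimately have "bdd_above ((\<lambda>x. infdist x (closure Q)) ` closure P)"
    by (intro bounded_imp_bdd_above compact_imp_bounded compact_continuous_image)
  then have "bdd_above ((\<lambda>x. infdist x (closure Q)) ` P)"
    by (rule bdd_above_mono) (use closure_subset in blast)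
  then have "\<And>x. x \<in> P \<Longrightarrow> infdist x (closure Q) \<le> hausdorff1 P Q"
    unfolding hausdorff1_def by (rule cSUP_upper2) auto
  then have "P \<subseteq> {x. infdist x (closure Q) \<le> hausdorff1 P Q}"
    by auto
  moreover have "closed {x. infdist x (closure Q) \<le> hausdorff1 P Q}"
    by (intro closed_Collect_le continuous_intros)
  ultimately show ?thesis
    using closure_minimal assms(3) by blast
qed

lemma hausdorff1_nonneg:
  assumes "P \<in> regions" "Q \<in> regions"
  shows "0 \<le> hausdorff1 P Q"
proof -
  obtain p where "p \<in> P"
    using assms by (auto simp: regions_def)
  then have "infdist p (closure Q) \<le> hausdorff1 P Q"
    using infdist_le_hausdorff1[OF assms] closure_subset by blast
  then show ?thesis
    using infdist_nonneg order_trans by blast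
qed

lemma hausdorff1_triangle:
  fixes P Q R :: "'a::euclidean_space set"
  assumes "P \<in> regions" "Q \<in> regions" "R \<in> regions"
  shows "hausdorff1 P R \<le> hausdorff1 P Q + hausdorff1 Q R"
proof -
  have "infdist p (closure R) \<le> hausdorff1 P Q + hausdorff1 Q R" if "p \<in> P" for p
  proof -
    obtain q where q: "q \<in> closure Q" "infdist p (closure Q) = dist p q"
      using infdist_attains_inf[of "closure Q" p] assms by (auto simp: regions_def)
    have "infdist p (closure R) \<le> infdist q (closure R) + dist p q"
      by (rule infdist_triangle)
    moreover have "infdist q (closure R) \<le> hausdorff1 Q R"
      using infdist_le_hausdorff1 assms q by blast
    moreover have "infdist p (closure Q) \<le> hausdorff1 P Q"
      using infdist_le_hausdorff1 assms that closure_subset by blast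
    ultimately show ?thesis using q by linarith
  qed
  moreover have "P \<noteq> {}"
    using assms by (simp add: regions_def)
  ultimately show ?thesis
    unfolding hausdorff1_def[of P R] by (intro cSUP_least)
qed

lemma hausdorff1_le_0D:
  assumes "P \<in> regions" "Q \<in> regions" "hausdorff1 P Q \<le> 0"
  shows "P \<subseteq> Q"
proof -
  have "p \<in> closure Q" if "p \<in> P" for p
  proof -
    have "infdist p (closure Q) \<le> hausdorff1 P Q"
      using infdist_le_hausdorff1 assms that closure_subset by blast
    then have "infdist p (closure Q) = 0"
      using assms(3) infdist_nonneg[of p "closure Q"] by linarith
    moreover have "closure Q \<noteq> {}"
      using assms by (simp add: regions_def)
    ultimately show ?thesis
      using in_closed_iff_infdist_zero closed_closure by blast
  qed
  then have "P \<subseteq> interior (closure Q)"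
    using assms by (intro interior_maximal) (auto simp: regions_def)
  then show ?thesis
    using assms by (simp add: regions_def)
qed

lemma hausdorff1_refl: "P \<in> regions \<Longrightarrow> hausdorff1 P P = 0"
proof -
  assume P: "P \<in> regions"
  then have "P \<noteq> {}" by (simp add: regions_def)
  moreover have "\<And>p. p \<in> P \<Longrightarrow> infdist p (closure P) = 0"
    using closure_subset by (auto intro: infdist_zero)
  ultimately show ?thesis by (simp add: hausdorff1_def)
qed

lemma Metric_space_hausdorff_dist: "Metric_space regions hausdorff_dist"
proof
  fix P Q R :: "'a set"
  show "0 \<le> hausdorff_dist P Q"
    by (simp add: hausdorff_dist_def hausdorff1_nonneg le_max_iff_disj)
  show "hausdorff_dist P Q = hausdorff_dist Q P"
    by (simp add: hausdorff_dist_def max.commute)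
  show "hausdorff_dist P Q = 0 \<longleftrightarrow> P = Q" if "P \<in> regions" "Q \<in> regions"
  proof
    assume "hausdorff_dist P Q = 0"
    then have "hausdorff1 P Q \<le> 0" "hausdorff1 Q P \<le> 0"
      using that by (auto simp: hausdorff_dist_def max_def split: if_splits)
    then show "P = Q"
      using hausdorff1_le_0D that by blast
  qed (use that in \<open>simp add: hausdorff_dist_def hausdorff1_refl\<close>)
  show "hausdorff_dist P R \<le> hausdorff_dist P Q + hausdorff_dist Q R"
    if "P \<in> regions" "Q \<in> regions" "R \<in> regions"
    using hausdorff1_triangle[of P Q R] hausdorff1_triangle[of R Q P] that
    unfolding hausdorff_dist_def by auto
qed

end

theory Submission
  imports Defs
begin

text \<open>Both topologies are metrizable, so it suffices that they have the same convergent sequences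
  of convex regions.

  If \<open>P k\<close> tends to \<open>Q\<close> in the Hausdorff metric, then around an interior point of \<open>Q\<close> taken
  as the origin the Minkowski gauges of \<open>P k\<close> tend uniformly on the unit sphere to the gauge of
  \<open>Q\<close>. Placing \<open>P k\<close> at time \<open>1 / (k + 1)\<close> and \<open>Q\<close> at time \<open>0\<close>, the gauges form a continuous
  function on a closed subset of time \<open>\<times>\<close> sphere, which the Tietze theorem extends to all times.
  Stretching the rays from the origin accordingly, with the identity far out, gives a morphing
  that passes through \<open>P k\<close> at time \<open>1 / (k + 1)\<close>; continuity of its history at time \<open>0\<close> is
  the convergence with respect to \<open>\<mu>\<close>.

  Conversely, let \<open>P k\<close> tend to \<open>Q\<close> with respect to \<open>\<mu>\<close>. By the second separation condition \<open>P k\<close>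
  eventually meets finitely many small balls in \<open>Q\<close> that are dense up to a given error; hence no
  point of \<open>Q\<close> is far from \<open>P k\<close>, and \<open>P k\<close> eventually contains a fixed ball. If \<open>P k\<close> had a point
  far from \<open>Q\<close>, the convex hull of that point and the fixed ball would contain a ball of fixed size
  outside \<open>Q\<close> at bounded distance, hence one of finitely many fixed balls, which the first
  separation condition rules out eventually.\<close>

subsection \<open>Minkowski gauges of convex bodies\<close>

definition minkowski_gauge :: "'a::real_vector set \<Rightarrow> 'a \<Rightarrow> real" where
  "minkowski_gauge P x = Inf {l. 0 < l \<and> x /\<^sub>R l \<in> P}"

text \<open>The radii are parameters of the locale, so that one pair \<open>r\<close>,
  \<open>R\<close> can serve a whole sequence of bodies and bound all their gauges
  uniformly.\<close>

locale convex_body =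
  fixes P :: "'a::euclidean_space set" and r R :: real
  assumes open_body: "open P" and convex_body: "convex P"
    and r_pos: "0 < r" and ball_subset: "ball 0 r \<subseteq> P" and subset_ball: "P \<subseteq> ball 0 R"
begin

lemma zero_in_body: "0 \<in> P"
  using ball_subset r_pos by auto

lemma R_pos: "0 < R"
  using zero_in_body subset_ball by auto

lemma r_le_R: "r \<le> R"
proof (rule ccontr)
  assume "\<not> r \<le> R"
  obtain b :: 'a where b: "b \<in> Basis" using nonempty_Basis by blast
  have "R *\<^sub>R b \<in> ball 0 r"
    using \<open>\<not> r \<le> R\<close> R_pos b by simp
  then have "R *\<^sub>R b \<in> ball 0 R"
    using ball_subset subset_ball by blast
  then show False
    using R_pos b by simp
qed

text \<open>Ensures that \<open>Inf\<close> in the gauge is never the unspecified infimum of the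
  empty set. In the witness, the summand 1 keeps the scale positive at \<open>x = 0\<close>.\<close>

lemma gauge_set_nonempty: "\<exists>l>0. x /\<^sub>R l \<in> P"
proof -
  have "norm (x /\<^sub>R ((norm x + 1) / r)) < r"
    using r_pos by (simp add: field_simps add_pos_nonneg)
  then have "x /\<^sub>R ((norm x + 1) / r) \<in> P"
    using ball_subset by auto
  moreover have "(norm x + 1) / r > 0"
    using r_pos by (simp add: add_nonneg_pos)
  ultimately show ?thesis by blast
qed

text \<open>Since \<open>P\<close> is convex and contains \<open>0\<close>, the set under
  \<open>Inf\<close> is closed upwards; since \<open>P\<close> is open, that set does not contain
  its infimum. The facts below on gauges reduce to membership in \<open>P\<close> through this
  equivalence.\<close>

lemma gauge_less_iff:
  assumes "0 < l"
  shows "minkowski_gauge P x < l \<longleftrightarrow> x /\<^sub>R l \<in> P"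
proof
  assume "minkowski_gauge P x < l"
  then obtain m where m: "0 < m" "x /\<^sub>R m \<in> P" "m < l"
    unfolding minkowski_gauge_def
    using cInf_lessD[of "{l. 0 < l \<and> x /\<^sub>R l \<in> P}" l] gauge_set_nonempty[of x] by auto
  have "(m / l) *\<^sub>R (x /\<^sub>R m) + (1 - m / l) *\<^sub>R 0 \<in> P"
    by (rule convexD[OF convex_body]) (use m zero_in_body assms in \<open>auto simp: field_simps\<close>)
  then show "x /\<^sub>R l \<in> P"
    using m by (simp add: field_simps)
next
  assume l: "x /\<^sub>R l \<in> P"
  have "((\<lambda>m. x /\<^sub>R m) \<longlongrightarrow> x /\<^sub>R l) (at_left l)"
    by (intro tendsto_intros) (use assms in auto)
  then have "\<forall>\<^sub>F m in at_left l. x /\<^sub>R m \<in> P"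
    using open_body l by (rule topological_tendstoD)
  moreover have "\<forall>\<^sub>F m in at_left l. m \<in> {0<..<l}"
    by (rule eventually_at_leftI[OF _ assms]) auto
  ultimately have "\<forall>\<^sub>F m in at_left l. 0 < m \<and> m < l \<and> x /\<^sub>R m \<in> P"
    by eventually_elim auto
  then obtain m where m: "0 < m" "m < l" "x /\<^sub>R m \<in> P"
    using eventually_happens[of _ "at_left l"] by auto
  have "minkowski_gauge P x \<le> m"
    unfolding minkowski_gauge_def by (rule cInf_lower) (use m in \<open>auto intro!: bdd_belowI[of _ 0]\<close>)
  then show "minkowski_gauge P x < l"
    using m by simp
qed

lemma gauge_nonneg: "0 \<le> minkowski_gauge P x"
  unfolding minkowski_gauge_def by (rule cInf_greatest) (use gauge_set_nonempty in auto)

lemma gauge_le: "minkowski_gauge P x \<le> norm x / r"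
proof (rule dense_ge)
  fix l assume l: "norm x / r < l"
  then have "0 < l"
    using r_pos by (metis divide_nonneg_pos norm_ge_zero order_le_less_trans)
  moreover have "x /\<^sub>R l \<in> ball 0 r"
    using l \<open>0 < l\<close> r_pos by (simp add: field_simps)
  ultimately show "minkowski_gauge P x \<le> l"
    using gauge_less_iff ball_subset by (meson less_imp_le subsetD)
qed

lemma gauge_ge: "norm x / R \<le> minkowski_gauge P x"
proof (rule dense_ge)
  fix l assume l: "minkowski_gauge P x < l"
  then have "0 < l"
    using gauge_nonneg[of x] by linarith
  then have "x /\<^sub>R l \<in> ball 0 R"
    using gauge_less_iff subset_ball l by blast
  then show "norm x / R \<le> l"
    using \<open>0 < l\<close> R_pos by (simp add: field_simps)
qed

lemma gauge_scale:
  assumes "0 < c"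
  shows "minkowski_gauge P (c *\<^sub>R x) = c * minkowski_gauge P x"
proof -
  \<comment> \<open>The comparison is available for positive \<open>l\<close> only. As both gauges
    are nonnegative, every \<open>l\<close> above one of the two sides is positive, so this
    suffices.\<close>
  have *: "minkowski_gauge P (c *\<^sub>R x) < l \<longleftrightarrow> c * minkowski_gauge P x < l" if "0 < l" for l
    using gauge_less_iff[OF that, of "c *\<^sub>R x"] gauge_less_iff[of "l / c" x] assms that
    by (simp add: field_simps)
  show ?thesis
  proof (rule order_antisym)
    show "minkowski_gauge P (c *\<^sub>R x) \<le> c * minkowski_gauge P x"
      by (rule dense_ge) (use * gauge_nonneg[of x] assms in
          \<open>metis less_eq_real_def mult_nonneg_nonneg order_le_less_trans\<close>)
    show "c * minkowski_gauge P x \<le> minkowski_gauge P (c *\<^sub>R x)"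
      by (rule dense_ge) (use * gauge_nonneg[of "c *\<^sub>R x"] in
          \<open>metis less_eq_real_def order_le_less_trans\<close>)
  qed
qed

lemma gauge_add: "minkowski_gauge P (x + y) \<le> minkowski_gauge P x + minkowski_gauge P y"
proof (rule field_le_epsilon)
  fix e :: real assume "0 < e"
  define l m where "l = minkowski_gauge P x + e / 2" and "m = minkowski_gauge P y + e / 2"
  have pos: "0 < l" "0 < m"
    using gauge_nonneg[of x] gauge_nonneg[of y] \<open>0 < e\<close> by (auto simp: l_def m_def)
  have "x /\<^sub>R l \<in> P" "y /\<^sub>R m \<in> P"
    using gauge_less_iff[OF pos(1), of x] gauge_less_iff[OF pos(2), of y] \<open>0 < e\<close>
    by (auto simp: l_def m_def)
  \<comment> \<open>Weights proportional to \<open>l\<close> and \<open>m\<close> cancel the two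
    scalings and leave \<open>x + y\<close> over \<open>l + m\<close>.\<close>
  then have "(l / (l + m)) *\<^sub>R (x /\<^sub>R l) + (m / (l + m)) *\<^sub>R (y /\<^sub>R m) \<in> P"
    by (rule convexD[OF convex_body]) (use pos in \<open>auto simp flip: add_divide_distrib\<close>)
  also have "(l / (l + m)) *\<^sub>R (x /\<^sub>R l) + (m / (l + m)) *\<^sub>R (y /\<^sub>R m) = (x + y) /\<^sub>R (l + m)"
    using pos by (simp add: field_simps)
  finally have "minkowski_gauge P (x + y) < l + m"
    using gauge_less_iff pos by simp
  then show "minkowski_gauge P (x + y) \<le> minkowski_gauge P x + minkowski_gauge P y + e"
    by (simp add: l_def m_def)
qed

text \<open>Subadditivity bounds the difference by the gauges of \<open>x - y\<close> and
  \<open>y - x\<close>. The constant depends on \<open>r\<close> alone, so it is common to all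
  bodies around the same ball.\<close>

lemma gauge_lipschitz: "\<bar>minkowski_gauge P x - minkowski_gauge P y\<bar> \<le> norm (x - y) / r"
  using gauge_add[of "x - y" y] gauge_add[of "y - x" x] gauge_le[of "x - y"] gauge_le[of "y - x"]
  by (simp add: norm_minus_commute)

text \<open>The inverse gauge of a unit vector is the distance from the origin to the boundary in
  that direction. This is the form in which a body enters radial stretching.\<close>

lemma mem_body_iff:
  "x \<in> P \<longleftrightarrow> norm x < inverse (minkowski_gauge P (sgn x))" if "x \<noteq> 0"
proof -
  have "x \<in> P \<longleftrightarrow> minkowski_gauge P (norm x *\<^sub>R sgn x) < 1"
    using gauge_less_iff[of 1 x] that by (simp add: sgn_div_norm)
  also have "\<dots> \<longleftrightarrow> norm x * minkowski_gauge P (sgn x) < 1"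
    using that by (subst gauge_scale) auto
  also have "\<dots> \<longleftrightarrow> norm x < inverse (minkowski_gauge P (sgn x))"
  proof -
    have "0 < norm (sgn x) / R" using that R_pos by (simp add: norm_sgn)
    then have "0 < minkowski_gauge P (sgn x)"
      using gauge_ge[of "sgn x"] by linarith
    then show ?thesis by (simp add: field_simps)
  qed
  finally show ?thesis .
qed

end

text \<open>The last premise says that \<open>P\<close> lies in \<open>Q\<close> scaled by
  \<open>c\<close>; a larger body has a smaller gauge, and scaling the body by \<open>c\<close>
  divides its gauge by \<open>c\<close>.\<close>

lemma gauge_compare:
  assumes P: "convex_body P r R" and Q: "convex_body Q r R" and "0 < c"
    and sub: "\<And>x. x \<in> P \<Longrightarrow> x /\<^sub>R c \<in> Q"
  shows "minkowski_gauge Q x \<le> c * minkowski_gauge P x"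
proof -
  interpret P: convex_body P r R by fact
  interpret Q: convex_body Q r R by fact
  have "minkowski_gauge Q x / c \<le> l" if l: "minkowski_gauge P x < l" for l
  proof -
    have "0 < l" using P.gauge_nonneg[of x] l by linarith
    then have "(x /\<^sub>R l) /\<^sub>R c \<in> Q" using P.gauge_less_iff sub l by blast
    then have "minkowski_gauge Q x < c * l"
      using Q.gauge_less_iff[of "c * l" x] \<open>0 < c\<close> \<open>0 < l\<close> by (simp add: field_simps)
    then show ?thesis using \<open>0 < c\<close> by (simp add: field_simps)
  qed
  then have "minkowski_gauge Q x / c \<le> minkowski_gauge P x"
    by (rule dense_ge)
  then show ?thesis using \<open>0 < c\<close> by (simp add: field_simps)
qed

text \<open>Each gauge exceeds the other by at most \<open>e\<close> times a gauge, and gauges are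
  at most \<open>1 / r\<close> on the unit sphere.\<close>

lemma gauge_close:
  assumes P: "convex_body P r R" and Q: "convex_body Q r R" and "0 \<le> e" "norm u = 1"
    and "\<And>x. x \<in> P \<Longrightarrow> x /\<^sub>R (1 + e) \<in> Q" "\<And>x. x \<in> Q \<Longrightarrow> x /\<^sub>R (1 + e) \<in> P"
  shows "\<bar>minkowski_gauge P u - minkowski_gauge Q u\<bar> \<le> e / r"
proof -
  interpret P: convex_body P r R by fact
  interpret Q: convex_body Q r R by fact
  have "minkowski_gauge Q u \<le> (1 + e) * minkowski_gauge P u"
    by (rule gauge_compare[OF P Q]) (use assms in auto)
  moreover have "minkowski_gauge P u \<le> (1 + e) * minkowski_gauge Q u"
    by (rule gauge_compare[OF Q P]) (use assms in auto)
  moreover have "e * minkowski_gauge P u \<le> e / r" "e * minkowski_gauge Q u \<le> e / r"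
    using mult_left_mono[OF P.gauge_le \<open>0 \<le> e\<close>, of u] mult_left_mono[OF Q.gauge_le \<open>0 \<le> e\<close>, of u]
      assms by auto
  ultimately show ?thesis by (simp add: algebra_simps abs_le_iff)
qed

subsection \<open>Radial stretching\<close>

text \<open>The piecewise linear map of \<open>[0, \<infinity>)\<close> with \<open>0 \<mapsto> 0\<close>, \<open>a \<mapsto> b\<close>, \<open>M \<mapsto> M\<close> that is the identity
  beyond \<open>M\<close>, in a form whose continuity in all variables is evident.\<close>

definition stretch :: "real \<Rightarrow> real \<Rightarrow> real \<Rightarrow> real \<Rightarrow> real" where
  "stretch M a b s =
     min s a * (b / a) + (min (max s a) M - a) * ((M - b) / (M - a)) + (max s M - M)"

lemma stretch_id: "0 < a \<Longrightarrow> a < M \<Longrightarrow> stretch M a a s = s"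
  by (auto simp: stretch_def)

lemma stretch_fixes_outside: "0 < a \<Longrightarrow> a < M \<Longrightarrow> M \<le> s \<Longrightarrow> stretch M a b s = s"
  by (auto simp: stretch_def)

lemma stretch_pos:
  assumes "0 < a" "a < M" "0 < b" "b < M" "0 < s"
  shows "0 < stretch M a b s"
proof -
  have "0 < min s a * (b / a)" "0 \<le> (min (max s a) M - a) * ((M - b) / (M - a))"
    using assms by (auto intro!: mult_nonneg_nonneg divide_nonneg_nonneg mult_pos_pos divide_pos_pos)
  then show ?thesis
    unfolding stretch_def by linarith
qed

lemma stretch_nonneg:
  assumes "0 < a" "a < M" "0 < b" "b < M" "0 \<le> s"
  shows "0 \<le> stretch M a b s"
  using stretch_pos[OF assms(1-4), of s] assms by (cases "s = 0") (auto simp: stretch_def)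

lemma stretch_less_iff:
  assumes "0 < a" "a < M" "0 < b" "b < M"
  shows "stretch M a b s < b \<longleftrightarrow> s < a"
proof (cases "s < a")
  case True
  then show ?thesis using assms by (auto simp: stretch_def field_simps)
next
  case False
  then have "0 \<le> (min (max s a) M - a) * ((M - b) / (M - a))"
    using assms by (auto intro!: mult_nonneg_nonneg divide_nonneg_nonneg)
  then have "b \<le> stretch M a b s"
    using assms False unfolding stretch_def by auto
  then show ?thesis using False by auto
qed

text \<open>Exchanging \<open>a\<close> and \<open>b\<close> inverts each of the three linear
  pieces; the cases check that a point of one piece lands in the matching piece.\<close>

lemma stretch_inverse:
  assumes "0 < a" "a < M" "0 < b" "b < M"
  shows "stretch M b a (stretch M a b s) = s"
proof -
  consider "s < a" | "a \<le> s" "s < M" | "M \<le> s" by linarith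
  then show ?thesis
  proof cases
    case 1
    then have "stretch M a b s = s * (b / a)"
      using assms by (auto simp: stretch_def)
    moreover have "stretch M a b s < b"
      using 1 stretch_less_iff[OF assms] by simp
    ultimately show ?thesis
      using assms by (simp add: stretch_def[of M b a])
  next
    case 2
    define q where "q = (M - b) / (M - a)"
    have q: "0 < q" "(M - a) * q = M - b" using assms by (auto simp: q_def)
    have e: "stretch M a b s = b + (s - a) * q"
      using 2 assms by (auto simp: stretch_def q_def)
    have "(s - a) * q \<le> (M - a) * q"
      using 2 q by (intro mult_right_mono) auto
    moreover have "0 \<le> (s - a) * q"
      using 2 q by auto
    ultimately have "b \<le> stretch M a b s" "stretch M a b s \<le> M"
      using q e by auto
    then have "stretch M b a (stretch M a b s) = a + ((s - a) * q) * ((M - a) / (M - b))"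
      using assms e by (simp add: stretch_def[of M b a])
    also have "\<dots> = s"
      using assms by (simp add: q_def)
    finally show ?thesis .
  next
    case 3
    then show ?thesis using assms by (simp add: stretch_fixes_outside)
  qed
qed

lemma stretch_le:
  assumes "0 < a" "a < M" "0 \<le> s" "s \<le> a"
  shows "stretch M a b s = s * (b / a)"
  using assms by (auto simp: stretch_def)

text \<open>\<open>f\<close> and \<open>g\<close> give the distance to the boundary of the source
  and of the target body as functions of the direction. At the origin \<open>sgn\<close> is 0, so
  the origin is fixed.\<close>

definition radial_stretch :: "real \<Rightarrow> ('a \<Rightarrow> real) \<Rightarrow> ('a \<Rightarrow> real) \<Rightarrow> 'a::real_normed_vector \<Rightarrow> 'a"
  where "radial_stretch M f g x = stretch M (f (sgn x)) (g (sgn x)) (norm x) *\<^sub>R sgn x"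

lemma norm_scaleR_sgn: "norm x *\<^sub>R sgn x = (x :: 'a::real_normed_vector)"
  by (cases "x = 0") (simp_all add: sgn_div_norm)

lemma radial_stretch_id:
  assumes "\<And>u. 0 < f u" "\<And>u. f u < M"
  shows "radial_stretch M f f x = x"
  using assms by (simp add: radial_stretch_def stretch_id norm_scaleR_sgn)

lemma radial_stretch_fixes_outside:
  assumes "\<And>u. 0 < f u" "\<And>u. f u < M" "M \<le> norm x"
  shows "radial_stretch M f g x = x"
  using assms by (simp add: radial_stretch_def stretch_fixes_outside norm_scaleR_sgn)

context
  fixes M :: real and f g :: "'a::real_normed_vector \<Rightarrow> real"
  assumes fg: "\<And>u. 0 < f u" "\<And>u. f u < M" "\<And>u. 0 < g u" "\<And>u. g u < M"
begin

lemma norm_radial_stretch: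
  "norm (radial_stretch M f g x) = (if x = 0 then 0 else stretch M (f (sgn x)) (g (sgn x)) (norm x))"
  using stretch_nonneg[OF fg(1,2,3,4), of "norm x" "sgn x" "sgn x"]
  by (simp add: radial_stretch_def norm_sgn)

lemma sgn_radial_stretch: "sgn (radial_stretch M f g x) = sgn x"
  using stretch_pos[OF fg(1,2,3,4), of "norm x" "sgn x" "sgn x"]
  by (cases "x = 0") (simp_all add: radial_stretch_def sgn_scaleR sgn_div_norm[of "sgn x"] norm_sgn)

lemma radial_stretch_inverse: "radial_stretch M g f (radial_stretch M f g x) = x"
  unfolding radial_stretch_def[of M g f] sgn_radial_stretch norm_radial_stretch
  by (auto simp: stretch_inverse fg norm_scaleR_sgn)

text \<open>The map keeps directions, so this is \<open>stretch_less_iff\<close> on each ray. At the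
  origin both sides hold because \<open>f\<close> and \<open>g\<close> are positive also at
  \<open>sgn 0 = 0\<close>.\<close>

lemma radial_stretch_mem_iff:
  "norm (radial_stretch M f g x) < g (sgn (radial_stretch M f g x)) \<longleftrightarrow> norm x < f (sgn x)"
  unfolding sgn_radial_stretch norm_radial_stretch
  using fg stretch_less_iff[OF fg(1,2,3,4)] by auto

end

text \<open>Off the origin the formula is built from continuous operations. At the origin
  \<open>sgn\<close> jumps and a norm estimate takes over. Both radii may depend on
  \<open>t\<close>, so that the inverse maps are covered as well.\<close>

lemma continuous_on_radial_stretch:
  fixes A B :: "'b::metric_space \<times> 'a::real_normed_vector \<Rightarrow> real"
  assumes cont: "continuous_on UNIV A" "continuous_on UNIV B" and "0 < r" "R < M"
    and bnd: "\<And>z. A z \<in> {r..R}" "\<And>z. B z \<in> {r..R}"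
  shows "continuous_on UNIV (\<lambda>(t, x). radial_stretch M (\<lambda>u. A (t, u)) (\<lambda>u. B (t, u)) x)"
proof -
  let ?F = "\<lambda>z. radial_stretch M (\<lambda>u. A (fst z, u)) (\<lambda>u. B (fst z, u)) (snd z)"
  have A: "0 < A z" "A z < M" "r \<le> A z" "A z \<le> R" for z
    using bnd(1)[of z, unfolded atLeastAtMost_iff] \<open>0 < r\<close> \<open>R < M\<close> by linarith+
  have B: "0 < B z" "B z < M" "r \<le> B z" "B z \<le> R" for z
    using bnd(2)[of z, unfolded atLeastAtMost_iff] \<open>0 < r\<close> \<open>R < M\<close> by linarith+
  have nz: "A z \<noteq> 0" "M \<noteq> A z" for z using A[of z] by linarith+
  have c1: "continuous_on T (\<lambda>z. A (h z))" "continuous_on T (\<lambda>z. B (h z))"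
    if "continuous_on T h" for T and h :: "'b \<times> 'a \<Rightarrow> 'b \<times> 'a"
    by (rule continuous_on_compose2[OF cont(1) that] continuous_on_compose2[OF cont(2) that]; simp)+
  have "open {z :: 'b \<times> 'a. snd z \<noteq> 0}"
    by (rule open_Collect_neq) (intro continuous_intros)+
  moreover have "continuous_on {z :: 'b \<times> 'a. snd z \<noteq> 0} ?F"
    unfolding radial_stretch_def stretch_def sgn_div_norm
    by (intro continuous_intros c1) (auto simp: nz)
  ultimately have off: "isCont ?F z" if "snd z \<noteq> 0" for z
    using that continuous_on_eq_continuous_at by blast
  have on: "isCont ?F z" if z: "snd z = 0" for z
  proof -
    have "\<forall>\<^sub>F w in at z. norm (snd w) < r"
    proof -
      have "((\<lambda>w. norm (snd w)) \<longlongrightarrow> norm (snd z)) (at z)"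
        by (intro tendsto_intros)
      then show ?thesis using z \<open>0 < r\<close> by (intro order_tendstoD(2)) auto
    qed
    \<comment> \<open>Within distance \<open>r\<close> of the origin only the first linear piece of
      \<open>stretch\<close> acts, and its slope is at most \<open>R / r\<close>.\<close>
    then have "\<forall>\<^sub>F w in at z. norm (?F w) \<le> norm (snd w) * (R / r)"
    proof eventually_elim
      case (elim w)
      let ?a = "A (fst w, sgn (snd w))" and ?b = "B (fst w, sgn (snd w))"
      have "norm (?F w) \<le> stretch M ?a ?b (norm (snd w))"
        using stretch_nonneg[of ?a M ?b "norm (snd w)"] A B
        by (auto simp: norm_radial_stretch)
      also have "\<dots> = norm (snd w) * (?b / ?a)"
        by (rule stretch_le) (use A[of "(fst w, sgn (snd w))"] elim in auto)
      also have "\<dots> \<le> norm (snd w) * (R / r)"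
        using A[of "(fst w, sgn (snd w))"] B[of "(fst w, sgn (snd w))"] \<open>0 < r\<close>
        by (intro mult_left_mono frac_le) auto
      finally show ?case .
    qed
    moreover have "((\<lambda>w. norm (snd w) * (R / r)) \<longlongrightarrow> norm (snd z) * (R / r)) (at z)"
      by (intro tendsto_intros) (use \<open>0 < r\<close> in auto)
    then have "((\<lambda>w. norm (snd w) * (R / r)) \<longlongrightarrow> 0) (at z)"
      by (simp only: z norm_zero mult_zero_left)
    ultimately have "(?F \<longlongrightarrow> 0) (at z)"
      by (rule Lim_null_comparison)
    then show ?thesis
      using z by (simp add: isCont_def radial_stretch_def)
  qed
  have "continuous_on UNIV ?F"
    using off on by (intro continuous_at_imp_continuous_on) blast
  then show ?thesis by (simp add: case_prod_unfold)
qed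

section \<open>Uniform continuity of maps that are the identity far out\<close>

text \<open>The displacement \<open>\<psi> t x - x\<close> is uniformly continuous on the compact
  set \<open>T \<times> cball 0 M\<close>. Composing it with the nearest-point projection to the
  ball, which does not increase distances, extends this to all \<open>x\<close>.\<close>

lemma uniformly_continuous_on_fixes_outside:
  fixes \<psi> :: "'b::metric_space \<Rightarrow> 'a::euclidean_space \<Rightarrow> 'a"
  assumes cont: "continuous_on (T \<times> UNIV) (\<lambda>(t, x). \<psi> t x)" and "compact T" "0 < M"
    and fix_out: "\<And>t x. t \<in> T \<Longrightarrow> M \<le> norm x \<Longrightarrow> \<psi> t x = x"
  shows "uniformly_continuous_on (T \<times> UNIV) (\<lambda>(t, x). \<psi> t x)"
proof -
  let ?D = "\<lambda>(t, x). \<psi> t x - x" and ?c = "closest_point (cball 0 M)"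
  have "continuous_on (T \<times> cball 0 M) ?D"
    using continuous_on_subset[OF cont, of "T \<times> cball 0 M"]
    by (auto simp: case_prod_unfold intro!: continuous_intros)
  then have unif: "uniformly_continuous_on (T \<times> cball 0 M) ?D"
    by (intro compact_uniformly_continuous compact_Times) (use assms in auto)
  have c: "?c x \<in> cball 0 M" for x
    using \<open>0 < M\<close> by (intro closest_point_in_set) auto
  have dist_le: "dist (fst z, ?c (snd z)) (fst w, ?c (snd w)) \<le> dist z w" for z w :: "'b \<times> 'a"
    using closest_point_lipschitz[of "cball 0 M :: 'a set" "snd z" "snd w"] \<open>0 < M\<close>
    by (cases z; cases w) (auto simp: dist_Pair_Pair intro!: real_sqrt_le_mono power_mono)
  have "uniformly_continuous_on (T \<times> UNIV) (\<lambda>z. ?D (fst z, ?c (snd z)))"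
    unfolding uniformly_continuous_on_def
  proof (intro allI impI)
    fix e :: real assume "0 < e"
    from unif[unfolded uniformly_continuous_on_def, rule_format, OF this] obtain d where d: "0 < d" "\<And>z w. z \<in> T \<times> cball 0 M \<Longrightarrow> w \<in> T \<times> cball 0 M \<Longrightarrow>
        dist w z < d \<Longrightarrow> dist (?D w) (?D z) < e"
      by blast
    show "\<exists>d>0. \<forall>z\<in>T \<times> UNIV. \<forall>w\<in>T \<times> UNIV. dist w z < d \<longrightarrow>
        dist (?D (fst w, ?c (snd w))) (?D (fst z, ?c (snd z))) < e"
    proof (intro exI[of _ d] conjI ballI impI d(1))
      fix z w :: "'b \<times> 'a" assume "z \<in> T \<times> UNIV" "w \<in> T \<times> UNIV" "dist w z < d"
      then show "dist (?D (fst w, ?c (snd w))) (?D (fst z, ?c (snd z))) < e"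
        using c order_le_less_trans[OF dist_le] by (intro d(2)) (auto simp: mem_Times_iff)
    qed
  qed
  then have "uniformly_continuous_on (T \<times> UNIV) (\<lambda>z. ?D (fst z, ?c (snd z)) + snd z)"
  proof (rule uniformly_continuous_on_add)
    show "uniformly_continuous_on (T \<times> UNIV) (snd :: 'b \<times> 'a \<Rightarrow> 'a)"
      unfolding uniformly_continuous_on_def using dist_snd_le by (meson order_le_less_trans)
  qed
  moreover have "?D (t, ?c x) + x = \<psi> t x" if "t \<in> T" for t x
  proof (cases "norm x \<le> M")
    case True
    then show ?thesis by (simp add: closest_point_self)
  next
    case False
    have ne: "interior (cball (0::'a) M) \<noteq> {}"
      using \<open>0 < M\<close> by simp
    \<comment> \<open>The nearest point of an outside \<open>x\<close> lies on the bounding sphere,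
      where the displacement is 0, as it is at \<open>x\<close> itself.\<close>
    then have "?c x \<notin> ball 0 M"
      using closest_point_in_rel_interior[of "cball 0 M" x] False \<open>0 < M\<close>
      by (auto simp: rel_interior_nonempty_interior[OF ne] affine_hull_nonempty_interior[OF ne])
    then show ?thesis
      using fix_out[OF that, of "?c x"] fix_out[OF that, of x] False by simp
  qed
  ultimately show ?thesis
    unfolding uniformly_continuous_on_def by (simp add: case_prod_unfold mem_Times_iff)
qed

subsection \<open>Morphings\<close>

text \<open>As \<open>closure P\<close> is compact, \<open>f\<close> commutes with closure; as the
  inverse is open, it carries the interior of the closed image into
  \<open>interior (closure P)\<close>, which is \<open>P\<close>.\<close>

lemma homeomorphism_image_region:
  fixes f :: "'a::euclidean_space \<Rightarrow> 'a"
  assumes hom: "homeomorphism UNIV UNIV f g" and P: "P \<in> regions"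
  shows "f ` P \<in> regions"
proof -
  have f: "continuous_on UNIV f" "\<And>x. g (f x) = x" "\<And>y. f (g y) = y" "range f = UNIV"
    using hom by (auto simp: homeomorphism_def)
  have op: "open (f ` S)" if "open S" for S
    using homeomorphism_imp_open_map[OF hom, of S] that by simp
  have op': "open (g ` S)" if "open S" for S
    using homeomorphism_imp_open_map[OF homeomorphism_symD[OF hom], of S] that
    by simp
  have P': "P \<noteq> {}" "bounded P" "open P" "interior (closure P) = P"
    using P by (auto simp: regions_def)
  have comp: "compact (f ` closure P)"
    using P' by (intro compact_continuous_image continuous_on_subset[OF f(1)]) auto
  have clos: "closure (f ` P) = f ` closure P"
  proof
    show "closure (f ` P) \<subseteq> f ` closure P"
      by (rule closure_minimal) (auto intro: compact_imp_closed comp simp: closure_subset image_mono)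
    show "f ` closure P \<subseteq> closure (f ` P)"
      by (rule image_closure_subset)
        (auto intro: continuous_on_subset[OF f(1)] simp: closure_subset)
  qed
  have "g ` interior (closure (f ` P)) \<subseteq> interior (closure P)"
    using interior_subset[of "closure (f ` P)"] f
    by (intro interior_maximal op' open_interior) (auto simp: clos)
  then have "f ` g ` interior (closure (f ` P)) \<subseteq> f ` P"
    using P' by auto
  then have "interior (closure (f ` P)) \<subseteq> f ` P"
    using f(3) by (simp add: image_image)
  moreover have "f ` P \<subseteq> interior (closure (f ` P))"
    by (intro interior_maximal closure_subset op P')
  moreover have "bounded (f ` P)"
    using comp by (meson bounded_subset closure_subset compact_imp_bounded image_mono)
  ultimately show ?thesis
    using P' op by (auto simp: regions_def)
qed

lemma morphing_limit:
  fixes \<psi> :: "real \<Rightarrow> 'a::euclidean_space \<Rightarrow> 'a"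
  assumes "supports_continuous_morphing T" "morphing \<psi>" "P \<in> regions"
  shows "limitin T (\<lambda>k. \<psi> (inverse (real (Suc k))) ` P) P sequentially"
proof -
  have 0: "\<psi> 0 ` P = P"
    using \<open>morphing \<psi>\<close> by (auto simp: morphing_def)
  have "history (\<lambda>t. \<psi> t ` P)"
    unfolding history_def
    using assms(2,3) homeomorphism_image_region unfolding morphing_def by blast
  moreover have "corresponds (\<lambda>t. \<psi> t ` P) \<psi>"
    by (simp add: corresponds_def 0)
  ultimately have "continuous_map (top_of_set {0..1}) T (\<lambda>t. \<psi> t ` P)"
    using assms unfolding supports_continuous_morphing_def by blast
  moreover have "limitin (top_of_set {0..1}) (\<lambda>k. inverse (real (Suc k))) 0 sequentially"
    using LIMSEQ_inverse_real_of_nat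
    by (auto simp: limitin_subtopology field_simps)
  ultimately have "limitin T ((\<lambda>t. \<psi> t ` P) \<circ> (\<lambda>k. inverse (real (Suc k)))) (\<psi> 0 ` P) sequentially"
    by (rule continuous_map_limit)
  then show ?thesis
    by (simp add: o_def 0)
qed

text \<open>Conjugation by a translation lets the gauge construction take any interior point as its
  origin.\<close>

lemma morphing_translate:
  fixes \<psi> :: "real \<Rightarrow> 'a::euclidean_space \<Rightarrow> 'a"
  assumes "morphing \<psi>"
  shows "morphing (\<lambda>t x. z + \<psi> t (x - z))"
proof -
  have uc: "uniformly_continuous_on ({0..1} \<times> UNIV) (\<lambda>(t, x). \<psi> t x)"
    and "\<And>x. \<psi> 0 x = x" and hom: "\<And>t. t \<in> {0..1} \<Longrightarrow> \<exists>g. homeomorphism UNIV UNIV (\<psi> t) g"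
    using assms by (auto simp: morphing_def)
  have iso: "dist (fst a, snd a - z) (fst b, snd b - z) = dist a b" for a b :: "real \<times> 'a"
    by (cases a; cases b) (simp add: dist_Pair_Pair dist_norm)
  have "uniformly_continuous_on ({0..1} \<times> UNIV) (\<lambda>(t, x). z + \<psi> t (x - z))"
    unfolding uniformly_continuous_on_def
  proof (intro allI impI)
    fix e :: real assume "0 < e"
    from uc[unfolded uniformly_continuous_on_def, rule_format, OF this] obtain d where d: "0 < d" "\<And>a b. a \<in> {0..1} \<times> UNIV \<Longrightarrow> b \<in> {0..1} \<times> UNIV \<Longrightarrow>
        dist b a < d \<Longrightarrow> dist (case b of (t, x) \<Rightarrow> \<psi> t x) (case a of (t, x) \<Rightarrow> \<psi> t x) < e"
      by blast
    show "\<exists>d>0. \<forall>a\<in>{0..1} \<times> UNIV. \<forall>b\<in>{0..1} \<times> UNIV. dist b a < d \<longrightarrow>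
        dist (case b of (t, x) \<Rightarrow> z + \<psi> t (x - z)) (case a of (t, x) \<Rightarrow> z + \<psi> t (x - z)) < e"
    proof (intro exI[of _ d] conjI ballI impI d(1))
      fix a b :: "real \<times> 'a"
      assume "a \<in> {0..1} \<times> UNIV" "b \<in> {0..1} \<times> UNIV" "dist b a < d"
      then show "dist (case b of (t, x) \<Rightarrow> z + \<psi> t (x - z)) (case a of (t, x) \<Rightarrow> z + \<psi> t (x - z)) < e"
        using d(2)[of "(fst a, snd a - z)" "(fst b, snd b - z)"] iso[of b a]
        by (simp add: case_prod_unfold mem_Times_iff)
    qed
  qed
  moreover have "homeomorphism UNIV UNIV (\<lambda>x. z + \<psi> t (x - z)) (\<lambda>y. z + g (y - z))"
    if "homeomorphism UNIV UNIV (\<psi> t) g" for t g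
  proof -
    have g: "continuous_on UNIV (\<psi> t)" "continuous_on UNIV g"
      "\<And>x. g (\<psi> t x) = x" "\<And>y. \<psi> t (g y) = y"
      using that by (auto simp: homeomorphism_def)
    have "continuous_on UNIV (\<lambda>x. z + \<psi> t (x - z))" "continuous_on UNIV (\<lambda>x. z + g (x - z))"
      by (intro continuous_intros continuous_on_compose2[OF g(1)] continuous_on_compose2[OF g(2)]; simp)+
    then show ?thesis
      using g by (intro homeomorphismI) auto
  qed
  ultimately show ?thesis
    using hom \<open>\<And>x. \<psi> 0 x = x\<close> unfolding morphing_def by (metis add.commute diff_add_cancel)
qed

text \<open>\<open>A (t, u)\<close> is the distance to the boundary in direction \<open>u\<close> at
  time \<open>t\<close>. The inverse at time \<open>t\<close> exchanges the two radii, and beyond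
  \<open>M\<close> nothing moves, which gives uniform continuity.\<close>

lemma morphing_radial_stretch:
  fixes A :: "real \<times> 'a::euclidean_space \<Rightarrow> real"
  assumes cont: "continuous_on UNIV A" and "0 < r" "R < M" and bnd: "\<And>z. A z \<in> {r..R}"
  shows "morphing (\<lambda>t. radial_stretch M (\<lambda>u. A (0, u)) (\<lambda>u. A (t, u)))" (is "morphing ?\<psi>")
proof -
  have A: "0 < A z" "A z < M" for z
    using bnd[of z, unfolded atLeastAtMost_iff] \<open>0 < r\<close> \<open>R < M\<close> by linarith+
  have cont0: "continuous_on UNIV (\<lambda>z. A (0, snd z))"
    by (intro continuous_on_compose2[OF cont] continuous_intros) auto
  have c1: "continuous_on UNIV (\<lambda>(t, x). ?\<psi> t x)"
    using continuous_on_radial_stretch[OF cont0 cont \<open>0 < r\<close> \<open>R < M\<close> bnd bnd] by simp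
  have c2: "continuous_on UNIV (\<lambda>(t, x). radial_stretch M (\<lambda>u. A (t, u)) (\<lambda>u. A (0, u)) x)"
    using continuous_on_radial_stretch[OF cont cont0 \<open>0 < r\<close> \<open>R < M\<close> bnd bnd] by simp
  have slice: "continuous_on UNIV (f t)" if "continuous_on UNIV (\<lambda>(t, x). f t x)"
    for f :: "real \<Rightarrow> 'a \<Rightarrow> 'a" and t
    using continuous_on_compose2[OF that, of UNIV "\<lambda>x. (t, x)"]
    by (simp add: continuous_on_Pair continuous_on_const continuous_on_id)
  have "uniformly_continuous_on ({0..1} \<times> UNIV) (\<lambda>(t, x). ?\<psi> t x)"
    by (rule uniformly_continuous_on_fixes_outside[of _ _ M])
      (use c1 A order_less_trans[OF A(1) A(2)] in
        \<open>auto intro: continuous_on_subset radial_stretch_fixes_outside\<close>)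
  moreover have "homeomorphism UNIV UNIV (?\<psi> t) (radial_stretch M (\<lambda>u. A (t, u)) (\<lambda>u. A (0, u)))" for t
    by (rule homeomorphismI)
      (auto simp: radial_stretch_inverse A slice[OF c1] slice[OF c2])
  moreover have "?\<psi> 0 x = x" for x
    by (simp add: radial_stretch_id A)
  ultimately show ?thesis
    unfolding morphing_def by blast
qed

lemma morphing_through_sequence:
  fixes P :: "nat \<Rightarrow> 'a::euclidean_space set"
  assumes Q: "convex_body Q r R" and P: "\<And>k. convex_body (P k) r R"
    and lim: "\<And>e. 0 < e \<Longrightarrow> \<forall>\<^sub>F k in sequentially.
      (\<forall>x\<in>P k. x /\<^sub>R (1 + e) \<in> Q) \<and> (\<forall>x\<in>Q. x /\<^sub>R (1 + e) \<in> P k)"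
  shows "\<exists>\<psi>. morphing \<psi> \<and> (\<forall>k. \<psi> (inverse (real (Suc k))) ` Q = P k)"
proof -
  interpret Q: convex_body Q r R by fact
  define s where "s k = inverse (real (Suc k))" for k
  have inj_s: "inj s"
    by (auto simp: s_def inj_on_def)
  have s_pos: "0 < s k" for k
    by (simp add: s_def)
  have s_lim: "s \<longlonglongrightarrow> 0"
    unfolding s_def by (rule LIMSEQ_inverse_real_of_nat)
  define S where "S = insert 0 (range s)"
  \<comment> \<open>At times outside \<open>S\<close> the index \<open>inv s t\<close> is arbitrary,
    but \<open>B t\<close> is still one of the given bodies, so the bounds hold at every
    time.\<close>
  define B where "B t = (if t = 0 then Q else P (inv s t))" for t
  have B_s: "B (s k) = P k" for k
    using s_pos[of k] inj_s by (simp add: B_def)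
  have B_0: "B 0 = Q"
    by (simp add: B_def)
  have B: "convex_body (B t) r R" for t
    by (simp add: B_def P Q)
  have near: "\<exists>d>0. \<forall>t\<in>S. dist t t0 < d \<longrightarrow>
      (\<forall>u. norm u = 1 \<longrightarrow> \<bar>minkowski_gauge (B t) u - minkowski_gauge (B t0) u\<bar> \<le> e)"
    if "t0 \<in> S" "0 < e" for t0 e
  proof (cases "t0 = 0")
    case True
    \<comment> \<open>The tolerance is \<open>e * r\<close> because \<open>gauge_close\<close>
      divides it by \<open>r\<close>.\<close>
    have "0 < e * r" using that Q.r_pos by simp
    from lim[OF this] obtain N where N: "\<And>k x. N \<le> k \<Longrightarrow>
        (x \<in> P k \<longrightarrow> x /\<^sub>R (1 + e * r) \<in> Q) \<and> (x \<in> Q \<longrightarrow> x /\<^sub>R (1 + e * r) \<in> P k)"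
      unfolding eventually_sequentially by blast
    have "\<bar>minkowski_gauge (B t) u - minkowski_gauge (B 0) u\<bar> \<le> e"
      if t: "t \<in> S" "dist t 0 < s N" and u: "norm u = 1" for t u
    proof (cases "t = 0")
      case False
      then obtain k where k: "t = s k"
        using t by (auto simp: S_def)
      then have "s k < s N"
        using t s_pos[of k] by (simp add: dist_norm)
      then have "N \<le> k"
        by (simp add: s_def)
      then have "\<bar>minkowski_gauge (P k) u - minkowski_gauge Q u\<bar> \<le> e * r / r"
        using N \<open>0 < e * r\<close> by (intro gauge_close[OF P Q] u) auto
      then show ?thesis
        using Q.r_pos by (simp add: k B_s B_0)
    qed (use \<open>0 < e\<close> in simp)
    then show ?thesis
      using s_pos[of N] True by blast
  next
    case False
    then have "0 < t0" using that s_pos by (auto simp: S_def)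
    \<comment> \<open>A positive time is isolated in \<open>S\<close>: only finitely many members
      reach \<open>t0 / 2\<close>, and a finite set keeps a positive distance from \<open>t0\<close>
      apart from \<open>t0\<close> itself.\<close>
    then have "\<forall>\<^sub>F k in sequentially. s k < t0 / 2"
      by (intro order_tendstoD(2)[OF s_lim]) simp
    then obtain N where N: "\<And>k. N \<le> k \<Longrightarrow> s k < t0 / 2"
      unfolding eventually_sequentially by blast
    obtain d where d: "0 < d" "\<And>t. t \<in> s ` {..<N} \<Longrightarrow> t \<noteq> t0 \<Longrightarrow> d \<le> dist t0 t"
      using finite_set_avoid[of "s ` {..<N}" t0] by blast
    have "t = t0" if t: "t \<in> S" "dist t t0 < min d (t0 / 2)" for t
    proof (rule ccontr)
      assume "t \<noteq> t0"
      then have "t \<notin> s ` {..<N}"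
        using d(2)[of t] t by (auto simp: dist_commute)
      then have "\<And>k. t = s k \<Longrightarrow> N \<le> k"
        by (metis imageI lessThan_iff not_less)
      then have "t < t0 / 2"
        using t(1) N \<open>0 < t0\<close> unfolding S_def by auto
      then show False using t(2) unfolding dist_real_def by linarith
    qed
    then show ?thesis
      using d(1) \<open>0 < t0\<close> \<open>0 < e\<close>
      by (intro exI[of _ "min d (t0 / 2)"]) fastforce
  qed
  define K where "K = S \<times> sphere (0::'a) 1"
  have "compact S"
    unfolding S_def by (rule compact_sequence_with_limit[OF s_lim])
  then have "closed K"
    unfolding K_def by (intro closed_Times compact_imp_closed) auto
  \<comment> \<open>Joint continuity: the change in time is controlled by \<open>near\<close>,
    uniformly in the direction, and the change in direction by the common Lipschitz
    constant.\<close>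
  have cont: "continuous_on K (\<lambda>(t, u). minkowski_gauge (B t) u)"
    unfolding continuous_on_iff
  proof (intro ballI allI impI)
    fix z0 and e :: real assume "z0 \<in> K" "0 < e"
    then obtain t0 u0 where z0: "z0 = (t0, u0)" "t0 \<in> S" "norm u0 = 1"
      by (auto simp: K_def)
    obtain d where d: "0 < d" "\<And>t u. t \<in> S \<Longrightarrow> dist t t0 < d \<Longrightarrow> norm u = 1 \<Longrightarrow>
        \<bar>minkowski_gauge (B t) u - minkowski_gauge (B t0) u\<bar> \<le> e / 2"
      using near[OF \<open>t0 \<in> S\<close>, of "e / 2"] \<open>0 < e\<close> by auto
    show "\<exists>d>0. \<forall>z\<in>K. dist z z0 < d \<longrightarrow>
      dist (case z of (t, u) \<Rightarrow> minkowski_gauge (B t) u)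
        (case z0 of (t, u) \<Rightarrow> minkowski_gauge (B t) u) < e"
    proof (intro exI[of _ "min d (e * r / 2)"] conjI ballI impI)
      show "0 < min d (e * r / 2)"
        using d \<open>0 < e\<close> Q.r_pos by simp
      fix z assume "z \<in> K" and dist: "dist z z0 < min d (e * r / 2)"
      then obtain t u where z: "z = (t, u)" "t \<in> S" "norm u = 1"
        by (auto simp: K_def)
      have "dist t t0 < d" "norm (u - u0) < e * r / 2"
        using dist dist_fst_le[of z z0] dist_snd_le[of z z0] by (auto simp: z z0 dist_norm)
      then have "\<bar>minkowski_gauge (B t) u - minkowski_gauge (B t0) u\<bar> \<le> e / 2"
        "norm (u - u0) / r < e / 2"
        using d z Q.r_pos by (auto simp: field_simps)
      moreover have "\<bar>minkowski_gauge (B t0) u - minkowski_gauge (B t0) u0\<bar> \<le> norm (u - u0) / r"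
        by (rule convex_body.gauge_lipschitz[OF B])
      ultimately have "\<bar>minkowski_gauge (B t) u - minkowski_gauge (B t0) u0\<bar> < e"
        by linarith
      then show "dist (case z of (t, u) \<Rightarrow> minkowski_gauge (B t) u)
        (case z0 of (t, u) \<Rightarrow> minkowski_gauge (B t) u) < e"
        by (simp add: z z0 dist_real_def)
    qed
  qed
  have gauge_bounds: "minkowski_gauge (B t) u \<in> cbox (1 / R) (1 / r)" if "norm u = 1" for t u
    using convex_body.gauge_ge[OF B, of u t] convex_body.gauge_le[OF B, of t u] that by auto
  have "1 / R \<le> 1 / r"
    using Q.r_le_R Q.r_pos by (simp add: frac_le)
  \<comment> \<open>The extension keeps the bounds of the gauges, hence its inverse \<open>A\<close>
    stays between \<open>r\<close> and \<open>R\<close> for all times and vectors.\<close>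
  obtain G where G: "continuous_on UNIV G" "\<And>z. z \<in> K \<Longrightarrow> G z = (case z of (t, u) \<Rightarrow> minkowski_gauge (B t) u)"
    "\<And>z. G z \<in> cbox (1 / R) (1 / r)"
    by (rule Tietze_closed_interval_1[OF cont, of UNIV "1 / R" "1 / r"])
      (use \<open>closed K\<close> \<open>1 / R \<le> 1 / r\<close> gauge_bounds in \<open>auto simp: K_def\<close>)
  have G_bounds: "1 / R \<le> G z" "G z \<le> 1 / r" for z
    using G(3)[of z] by auto
  have G_pos: "0 < G z" for z
    using G_bounds(1)[of z] Q.R_pos by (meson divide_pos_pos less_le_trans zero_less_one)
  define A where "A z = inverse (G z)" for z
  have A_cont: "continuous_on UNIV A"
    unfolding A_def using G_pos by (intro continuous_intros G) (metis less_irrefl)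
  have A_bounds: "A z \<in> {r..R}" for z
    using G_bounds[of z] G_pos[of z] Q.r_pos Q.R_pos by (simp add: A_def field_simps)
  define M where "M = R + 1"
  have A: "0 < A z" "A z < M" for z
    using A_bounds[of z, unfolded atLeastAtMost_iff] Q.r_pos by (auto simp: M_def)
  have mem: "x \<in> B t \<longleftrightarrow> norm x < A (t, sgn x)" if "t \<in> S" for t x
  proof (cases "x = 0")
    \<comment> \<open>Here \<open>sgn x = 0\<close> is off the sphere, so \<open>A\<close> takes
      some value of the extension; its positivity is enough.\<close>
    case True
    then show ?thesis using convex_body.zero_in_body[OF B] A by simp
  next
    case False
    then have "G (t, sgn x) = minkowski_gauge (B t) (sgn x)"
      using that by (subst G(2)) (auto simp: K_def norm_sgn)
    then show ?thesis
      using convex_body.mem_body_iff[OF B False] by (simp add: A_def)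
  qed
  define \<psi> where "\<psi> = (\<lambda>t. radial_stretch M (\<lambda>u. A (0, u)) (\<lambda>u. A (t, u)))"
  have "morphing \<psi>"
    unfolding \<psi>_def by (rule morphing_radial_stretch[OF A_cont Q.r_pos _ A_bounds]) (simp add: M_def)
  moreover have "\<psi> (s k) ` Q = P k" for k
  proof -
    have k: "s k \<in> S" "0 \<in> S" by (auto simp: S_def)
    have iff: "\<psi> (s k) x \<in> P k \<longleftrightarrow> x \<in> Q" for x
      using mem[OF k(1), of "\<psi> (s k) x"] mem[OF k(2), of x]
        radial_stretch_mem_iff[of "\<lambda>u. A (0, u)" M "\<lambda>u. A (s k, u)" x] A
      by (simp add: B_s B_0 \<psi>_def)
    define h where "h = radial_stretch M (\<lambda>u. A (s k, u)) (\<lambda>u. A (0, u))"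
    have h: "\<psi> (s k) (h y) = y" for y
      unfolding \<psi>_def h_def by (rule radial_stretch_inverse) (rule A)+
    show ?thesis
    proof (intro equalityI subsetI)
      fix y assume "y \<in> P k"
      then have "h y \<in> Q" using iff[of "h y"] by (simp only: h)
      then show "y \<in> \<psi> (s k) ` Q" using h[of y] by (metis imageI)
    qed (use iff in \<open>auto simp only: image_iff\<close>)
  qed
  ultimately show ?thesis
    unfolding s_def by blast
qed

subsection \<open>Hausdorff distance of convex regions\<close>

lemma hausdorff1_le:
  assumes "P \<noteq> {}" "\<And>p. p \<in> P \<Longrightarrow> infdist p Q \<le> e"
  shows "hausdorff1 P Q \<le> e"
  unfolding hausdorff1_def using assms by (intro cSUP_least) (auto simp: infdist_eq_setdist)

lemma ball_region: "0 < e \<Longrightarrow> ball z e \<in> regions"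
  by (simp add: regions_def)

text \<open>If some \<open>x\<close> in the smaller ball missed \<open>Q\<close>, a hyperplane would
  separate it from \<open>Q\<close>. Moving \<open>x\<close> by \<open>s\<close> along the normal,
  away from \<open>Q\<close>, stays in the larger ball, hence in \<open>P\<close>, but ends at
  distance at least \<open>s\<close> from \<open>Q\<close>.\<close>

lemma ball_subset_if_hausdorff1_less:
  fixes P Q :: "'a::euclidean_space set"
  assumes P: "P \<in> regions" and Q: "Q \<in> convex_regions" and d: "hausdorff1 P Q < s"
    and sub: "ball z (r + s) \<subseteq> P"
  shows "ball z r \<subseteq> Q"
proof (rule ccontr)
  assume "\<not> ball z r \<subseteq> Q"
  then obtain x where x: "dist z x < r" "x \<notin> Q" by (meson mem_ball subsetI)
  have Q': "Q \<in> regions" "convex Q" "Q \<noteq> {}" using Q by (auto simp: convex_regions_def regions_def)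
  have "0 \<le> s" using d hausdorff1_nonneg[OF P Q'(1)] by linarith
  obtain a b where a: "a \<noteq> 0" "a \<bullet> x \<le> b" "\<And>q. q \<in> Q \<Longrightarrow> b \<le> a \<bullet> q"
    using separating_hyperplane_sets[of "{x}" Q] x Q' by auto
  have "Q \<subseteq> {q. b \<le> a \<bullet> q}" using a by auto
  then have cl: "closure Q \<subseteq> {q. b \<le> a \<bullet> q}"
    by (intro closure_minimal closed_halfspace_ge)
  define y where "y = x - s *\<^sub>R sgn a"
  have "dist z y \<le> dist z x + s"
    using dist_triangle[of z y x] \<open>0 \<le> s\<close> by (simp add: y_def dist_norm norm_sgn a)
  then have "y \<in> P" using sub x by auto
  then have "infdist y (closure Q) \<le> hausdorff1 P Q"
    using infdist_le_hausdorff1[OF P Q'(1)] closure_subset by blast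
  then have less: "infdist y (closure Q) < s" using d by linarith
  obtain q where q: "q \<in> closure Q" "infdist y (closure Q) = dist y q"
    using infdist_attains_inf[of "closure Q" y] Q' by auto
  have "a \<bullet> x \<le> a \<bullet> q" using cl q a by auto
  moreover have "a \<bullet> sgn a = norm a"
    by (simp add: sgn_div_norm dot_square_norm power2_eq_square a)
  ultimately have "s * norm a \<le> a \<bullet> (q - y)"
    by (simp add: y_def inner_diff_right)
  also have "\<dots> \<le> norm a * norm (q - y)" by (rule norm_cauchy_schwarz)
  finally have "s \<le> dist y q" using a by (simp add: dist_norm norm_minus_commute mult.commute)
  then show False using less q by simp
qed

text \<open>Turns Hausdorff closeness into the scaled inclusion that gauges need. If
  \<open>q\<close> is nearest to \<open>p\<close> in \<open>closure Q\<close>, the shrunken point is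
  a convex combination of \<open>q\<close> and \<open>z + (p - q) /\<^sub>R e\<close> with weights
  \<open>1 / (1 + e)\<close> and \<open>e / (1 + e)\<close>; the latter point lies in the ball
  around \<open>z\<close>.\<close>

lemma shrink_mem_if_hausdorff1_less:
  fixes P Q :: "'a::euclidean_space set"
  assumes P: "P \<in> regions" and Q: "Q \<in> convex_regions" and d: "hausdorff1 P Q < e * r"
    and sub: "ball z r \<subseteq> Q" and "0 < e" and "p \<in> P"
  shows "z + (p - z) /\<^sub>R (1 + e) \<in> Q"
proof -
  have Q': "Q \<in> regions" "convex Q" "Q \<noteq> {}" "open Q"
    using Q by (auto simp: convex_regions_def regions_def)
  obtain q where q: "q \<in> closure Q" "infdist p (closure Q) = dist p q"
    using infdist_attains_inf[of "closure Q" p] Q' by auto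
  have "infdist p (closure Q) \<le> hausdorff1 P Q"
    using infdist_le_hausdorff1[OF P Q'(1)] closure_subset \<open>p \<in> P\<close> by blast
  then have "dist p q < e * r" using q d by linarith
  then have "norm ((p - q) /\<^sub>R e) < r"
    using \<open>0 < e\<close> unfolding norm_scaleR by (simp add: dist_norm field_simps)
  then have "z + (p - q) /\<^sub>R e \<in> ball z r"
    by (simp only: mem_ball dist_norm) simp
  then have "z + (p - q) /\<^sub>R e \<in> interior Q"
    using sub interior_open[OF Q'(4)] by blast
  then have "q - (e / (1 + e)) *\<^sub>R (q - (z + (p - q) /\<^sub>R e)) \<in> interior Q"
    by (intro mem_interior_closure_convex_shrink Q' q) (use \<open>0 < e\<close> in auto)
  also have "q - (e / (1 + e)) *\<^sub>R (q - (z + (p - q) /\<^sub>R e)) = z + (p - z) /\<^sub>R (1 + e)"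
  proof -
    have "(1 + e) *\<^sub>R (q - (e / (1 + e)) *\<^sub>R (q - (z + (p - q) /\<^sub>R e))) =
        (1 + e) *\<^sub>R q - e *\<^sub>R (q - (z + (p - q) /\<^sub>R e))"
      using \<open>0 < e\<close> by (simp add: scaleR_diff_right)
    also have "\<dots> = p + e *\<^sub>R z"
      using \<open>0 < e\<close> by (simp add: algebra_simps)
    also have "\<dots> = (1 + e) *\<^sub>R (z + (p - z) /\<^sub>R (1 + e))"
      using \<open>0 < e\<close> by (simp add: scaleR_add_right scaleR_left_distrib)
    finally show ?thesis using \<open>0 < e\<close> by simp
  qed
  finally show ?thesis using Q' by (simp add: interior_open)
qed

lemma limitin_hausdorff_iff:
  fixes P :: "nat \<Rightarrow> 'a::euclidean_space set"
  assumes "range P \<subseteq> regions" "Q \<in> regions"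
  shows "limitin (Metric_space.mtopology regions hausdorff_dist) P Q sequentially \<longleftrightarrow>
    (\<forall>e>0. \<forall>\<^sub>F k in sequentially. hausdorff1 (P k) Q < e \<and> hausdorff1 Q (P k) < e)"
proof -
  have "P k \<in> regions" for k using assms by auto
  then show ?thesis
    using assms(2)
    by (simp add: Metric_space.limitin_metric[OF Metric_space_hausdorff_dist] hausdorff_dist_def)
qed

lemma limitin_morphing_of_limitin_hausdorff:
  fixes P :: "nat \<Rightarrow> 'a::euclidean_space set"
  assumes T: "supports_continuous_morphing T"
    and P: "range P \<subseteq> convex_regions" and Q: "Q \<in> convex_regions"
    and lim: "limitin (Metric_space.mtopology regions hausdorff_dist) P Q sequentially"
  shows "limitin T P Q sequentially"
proof -
  have Q': "Q \<in> regions" "open Q" "convex Q" "bounded Q" "Q \<noteq> {}"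
    using Q by (auto simp: convex_regions_def regions_def)
  have P': "P k \<in> convex_regions" "P k \<in> regions" "open (P k)" "convex (P k)" for k
    using P by (auto simp: convex_regions_def regions_def)
  have close: "\<forall>\<^sub>F k in sequentially. hausdorff1 (P k) Q < e \<and> hausdorff1 Q (P k) < e" if "0 < e" for e
    using lim that P' Q' by (subst (asm) limitin_hausdorff_iff) auto
  \<comment> \<open>The doubled radius leaves room to lose \<open>r\<close> when passing from
    \<open>Q\<close> to \<open>P k\<close>.\<close>
  obtain z r where r: "0 < r" "ball z (r + r) \<subseteq> Q"
  proof -
    obtain z where "z \<in> Q" using Q' by blast
    then obtain e where "0 < e" "ball z e \<subseteq> Q" using openE[OF \<open>open Q\<close>] by blast
    then show thesis using that[of "e / 2" z] by simp
  qed
  then have r': "ball z r \<subseteq> Q" by (meson order_trans subset_ball less_add_same_cancel1 less_imp_le)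
  obtain R where R: "0 < R" "Q \<subseteq> ball z R"
    using \<open>bounded Q\<close> by (metis bounded_subset_ballD)
  have "\<forall>\<^sub>F k in sequentially. ball z r \<subseteq> P k \<and> P k \<subseteq> ball z (2 * R)"
    using close[OF \<open>0 < r\<close>]
  proof eventually_elim
    case (elim k)
    have "p \<in> ball z (2 * R)" if "p \<in> P k" for p
    proof -
      \<comment> \<open>Shrinking with \<open>e = 1\<close> halves the distance to \<open>z\<close>,
        so the bound \<open>R\<close> for \<open>Q\<close> yields \<open>2 * R\<close> for
        \<open>P k\<close>.\<close>
      have "z + (p - z) /\<^sub>R (1 + 1) \<in> Q"
        by (rule shrink_mem_if_hausdorff1_less[OF P'(2) Q _ r' zero_less_one that]) (use elim in simp)
      then have "z + (p - z) /\<^sub>R 2 \<in> ball z R"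
        using R(2) by auto
      then show ?thesis
        by (simp add: dist_norm norm_minus_commute)
    qed
    then show ?case
      using ball_subset_if_hausdorff1_less[OF Q'(1) P'(1) _ r(2)] elim by auto
  qed
  \<comment> \<open>The members before \<open>N\<close> need not obey the common radii; the morphing
    is built for the shifted sequence.\<close>
  then obtain N where N: "\<And>k. N \<le> k \<Longrightarrow> ball z r \<subseteq> P k" "\<And>k. N \<le> k \<Longrightarrow> P k \<subseteq> ball z (2 * R)"
    unfolding eventually_sequentially by blast
  let ?c = "\<lambda>A. (\<lambda>x. x - z) ` A"
  have body: "convex_body (?c A) r (2 * R)"
    if "open A" "convex A" "ball z r \<subseteq> A" "A \<subseteq> ball z (2 * R)" for A
  proof
    show "ball 0 r \<subseteq> ?c A"
    proof
      fix x :: 'a assume "x \<in> ball 0 r"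
      then have "x + z \<in> A" using that(3) by (auto simp: dist_norm)
      then show "x \<in> ?c A" by force
    qed
    show "?c A \<subseteq> ball 0 (2 * R)"
      using that(4) by (auto simp: dist_norm norm_minus_commute)
  qed (use that \<open>0 < r\<close> open_translation_subtract convex_translation_subtract in auto)
  have Qb: "convex_body (?c Q) r (2 * R)"
    using R by (intro body Q' r') auto
  have Pb: "convex_body (?c (P (k + N))) r (2 * R)" for k
    by (intro body P' N) auto
  have shrink: "(x - z) /\<^sub>R (1 + e) \<in> ?c A" if "z + (x - z) /\<^sub>R (1 + e) \<in> A" for x e A
    using that by force
  have "\<exists>\<psi>. morphing \<psi> \<and> (\<forall>k. \<psi> (inverse (real (Suc k))) ` ?c Q = ?c (P (k + N)))"
  proof (rule morphing_through_sequence[OF Qb Pb])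
    fix e :: real assume "0 < e"
    then have "\<forall>\<^sub>F k in sequentially. hausdorff1 (P k) Q < e * r \<and> hausdorff1 Q (P k) < e * r"
      using close r by simp
    then have "\<forall>\<^sub>F k in sequentially. hausdorff1 (P (k + N)) Q < e * r \<and> hausdorff1 Q (P (k + N)) < e * r"
      by (rule eventually_compose_filterlim[OF _ filterlim_add_const_nat_at_top])
    then show "\<forall>\<^sub>F k in sequentially. (\<forall>x\<in>?c (P (k + N)). x /\<^sub>R (1 + e) \<in> ?c Q) \<and>
        (\<forall>x\<in>?c Q. x /\<^sub>R (1 + e) \<in> ?c (P (k + N)))"
    proof eventually_elim
      case (elim k)
      have "z + (x - z) /\<^sub>R (1 + e) \<in> Q" if "x \<in> P (k + N)" for x
        using shrink_mem_if_hausdorff1_less[OF P'(2) Q _ r' \<open>0 < e\<close> that] elim by blast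
      moreover have "z + (x - z) /\<^sub>R (1 + e) \<in> P (k + N)" if "x \<in> Q" for x
        using shrink_mem_if_hausdorff1_less[OF Q'(1) P'(1) _ N(1) \<open>0 < e\<close> that] elim by simp
      ultimately show ?case
        using shrink by blast
    qed
  qed
  then obtain \<psi> where \<psi>: "morphing \<psi>" "\<And>k. \<psi> (inverse (real (Suc k))) ` ?c Q = ?c (P (k + N))"
    by blast
  have "(\<lambda>x. z + \<psi> (inverse (real (Suc k))) (x - z)) ` Q = P (k + N)" for k
  proof -
    have "(\<lambda>x. z + \<psi> (inverse (real (Suc k))) (x - z)) ` Q =
        (+) z ` \<psi> (inverse (real (Suc k))) ` ?c Q"
      by (simp add: image_image)
    also have "\<dots> = P (k + N)"
      unfolding \<psi> by (simp add: image_image)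
    finally show ?thesis .
  qed
  then have "limitin T (\<lambda>k. P (k + N)) Q sequentially"
    using morphing_limit[OF T morphing_translate[OF \<psi>(1), of z] Q'(1)] by simp
  then show ?thesis
    by (rule limitin_sequentially_offset_rev)
qed

subsection \<open>Consequences of region separation\<close>

lemma eventually_of_neighbourhood:
  assumes "limitin T f l F" "neighbourhood_in T l U"
  shows "\<forall>\<^sub>F k in F. f k \<in> U"
proof -
  obtain V where V: "openin T V" "l \<in> V" "V \<subseteq> U"
    using assms(2) by (auto simp: neighbourhood_in_def)
  then have "\<forall>\<^sub>F k in F. f k \<in> V"
    using assms(1) by (simp add: limitin_def)
  then show ?thesis
    by (rule eventually_mono) (use V in blast)
qed

lemma eventually_meets_if_region_separation:
  assumes T: "region_separation T" and lim: "limitin T P Q F"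
    and "Q \<in> regions" "Z \<in> regions" "Z \<subseteq> Q"
  shows "\<forall>\<^sub>F k in F. P k \<inter> Z \<noteq> {}"
proof -
  obtain U where U: "neighbourhood_in T Q U" "\<not> (\<exists>A\<in>U. A \<inter> Z = {})"
    using bspec[OF bspec[OF T[unfolded region_separation_def] assms(3)] assms(4),
        THEN conjunct2, rule_format, OF assms(5)] by blast
  from eventually_of_neighbourhood[OF lim U(1)] show ?thesis
    by (rule eventually_mono) (use U(2) in blast)
qed

lemma eventually_not_superset_if_region_separation:
  assumes T: "region_separation T" and lim: "limitin T P Q F"
    and "Q \<in> regions" "Z \<in> regions" "Q \<inter> Z = {}"
  shows "\<forall>\<^sub>F k in F. \<not> Z \<subseteq> P k"
proof -
  obtain U where U: "neighbourhood_in T Q U" "\<not> (\<exists>A\<in>U. Z \<subseteq> A)"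
    using bspec[OF bspec[OF T[unfolded region_separation_def] assms(3)] assms(4),
        THEN conjunct1, rule_format, OF assms(5)] by blast
  from eventually_of_neighbourhood[OF lim U(1)] show ?thesis
    by (rule eventually_mono) (use U(2) in blast)
qed

lemma hausdorff1_limit_of_separation:
  fixes P :: "nat \<Rightarrow> 'a::euclidean_space set"
  assumes T: "region_separation T" and P: "range P \<subseteq> regions" and Q: "Q \<in> regions"
    and lim: "limitin T P Q sequentially" and "0 < e"
  shows "\<forall>\<^sub>F k in sequentially. hausdorff1 Q (P k) < e"
proof -
  have Q': "open Q" "Q \<noteq> {}" "compact (closure Q)" using Q by (auto simp: regions_def)
  \<comment> \<open>One \<open>e / 4\<close> leads from a point of \<open>Q\<close> to a centre,
    another from the centre to \<open>P k\<close>. The sum \<open>e / 2\<close> leaves a margin, as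
    a supremum yields only a weak inequality.\<close>
  have "closure Q \<subseteq> (\<Union>p\<in>Q. ball p (e / 4))"
  proof
    fix x assume "x \<in> closure Q"
    then obtain p where "p \<in> Q" "dist p x < e / 4"
      using closure_approachable[of x Q] \<open>0 < e\<close> by (meson divide_pos_pos zero_less_numeral)
    then show "x \<in> (\<Union>p\<in>Q. ball p (e / 4))" by auto
  qed
  then obtain F where F: "F \<subseteq> Q" "finite F" "closure Q \<subseteq> (\<Union>p\<in>F. ball p (e / 4))"
    by (rule compactE_image[OF Q'(3) open_ball])
  have "\<forall>\<^sub>F k in sequentially. \<exists>y\<in>P k. dist p y < e / 4" if "p \<in> F" for p
  proof -
    have "p \<in> Q" using that F(1) by blast
    then obtain s where s: "0 < s" "ball p s \<subseteq> Q"
      by (rule openE[OF Q'(1)])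
    \<comment> \<open>The radius keeps the test region both inside \<open>Q\<close>, as separation
      requires, and near \<open>p\<close>.\<close>
    define Z where "Z = ball p (min s (e / 4))"
    have Z: "Z \<in> regions" "Z \<subseteq> Q"
      using s \<open>0 < e\<close> by (auto simp: Z_def intro: ball_region)
    then have "\<forall>\<^sub>F k in sequentially. P k \<inter> Z \<noteq> {}"
      by (rule eventually_meets_if_region_separation[OF T lim Q])
    then show ?thesis
      by (rule eventually_mono) (auto simp: Z_def)
  qed
  then have "\<forall>\<^sub>F k in sequentially. \<forall>p\<in>F. \<exists>y\<in>P k. dist p y < e / 4"
    using F(2) by (simp add: eventually_ball_finite)
  then show ?thesis
  proof eventually_elim
    case (elim k)
    have "infdist x (P k) \<le> e / 2" if "x \<in> Q" for x
    proof -
      have "x \<in> (\<Union>p\<in>F. ball p (e / 4))"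
        using F(3) that closure_subset by (meson subsetD)
      then obtain p where p: "p \<in> F" "dist p x < e / 4"
        by auto
      then obtain y where y: "y \<in> P k" "dist p y < e / 4" using elim by blast
      have "infdist x (P k) \<le> dist x y" using y by (intro infdist_le)
      also have "\<dots> \<le> dist p x + dist p y" by (rule dist_triangle3)
      finally show ?thesis using p y by simp
    qed
    then have "hausdorff1 Q (P k) \<le> e / 2" by (intro hausdorff1_le Q')
    then show ?case using \<open>0 < e\<close> by simp
  qed
qed

text \<open>The radius \<open>\<rho>\<close> depends neither on \<open>P\<close> nor on \<open>p\<close>.\<close>

lemma convex_ball_outside:
  fixes P Q :: "'a::euclidean_space set"
  assumes "convex P" "ball z r \<subseteq> P" "0 < r" "z \<in> Q" "Q \<subseteq> ball z R" "p \<in> P" "0 < e" "e \<le> infdist p Q"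
    and \<rho>: "\<rho> = min (e / 2) (e / (2 * (R + e)) * r)"
  shows "\<exists>y \<in> cball z (R + e). ball y \<rho> \<subseteq> P \<and> ball y \<rho> \<inter> Q = {}"
proof -
  have "0 < R" using assms(4,5) by auto
  have "z \<in> P" using assms by auto
  \<comment> \<open>Since \<open>p\<close> may be arbitrarily far away, it is replaced by a point of
    the segment from \<open>z\<close> at distance exactly \<open>e\<close> from \<open>Q\<close>,
    which is within \<open>R + e\<close> of \<open>z\<close>.\<close>
  define g where "g t = infdist (z + t *\<^sub>R (p - z)) Q" for t :: real
  have "continuous_on {0..1} g"
    unfolding g_def by (intro continuous_intros)
  moreover have "g 0 \<le> e" "e \<le> g 1"
    using assms by (auto simp: g_def)
  ultimately obtain t where t: "0 \<le> t" "t \<le> 1" "g t = e"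
    using IVT'[of g 0 e 1] by auto
  define x where "x = z + t *\<^sub>R (p - z)"
  have "x = (1 - t) *\<^sub>R z + t *\<^sub>R p"
    by (simp add: x_def algebra_simps)
  then have "x \<in> P"
    using convexD[OF \<open>convex P\<close> \<open>z \<in> P\<close> \<open>p \<in> P\<close>, of "1 - t" t] t by simp
  have x: "infdist x Q = e"
    using t by (simp add: x_def g_def)
  have "dist z x \<le> R + e"
  proof (rule field_le_epsilon)
    fix d :: real assume "0 < d"
    then have "infdist x Q < e + d" using x by simp
    then obtain q where "q \<in> Q" "dist x q < e + d"
      using assms(4) by (auto simp: infdist_def cInf_less_iff split: if_splits)
    then show "dist z x \<le> R + e + d"
      using assms(5) dist_triangle[of z x q] by (fastforce simp: dist_commute)
  qed
  \<comment> \<open>Moving from \<open>x\<close> towards \<open>z\<close> by the fraction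
    \<open>s\<close> covers at most \<open>e / 2\<close>. Then a ball of radius at most
    \<open>e / 2\<close> around the new point \<open>y\<close> still misses
    \<open>Q\<close>.\<close>
  define s where "s = e / (2 * (R + e))"
  have s: "0 < s" "s \<le> 1" "s * (R + e) = e / 2"
    using \<open>0 < e\<close> \<open>0 < R\<close> by (auto simp: s_def field_simps)
  define y where "y = x + s *\<^sub>R (z - x)"
  have "dist x y = s * dist z x"
    using s by (simp add: y_def dist_norm)
  then have "dist x y \<le> e / 2"
    using s(1,3) mult_left_mono[OF \<open>dist z x \<le> R + e\<close>, of s] by linarith
  have "dist z y = (1 - s) * dist z x"
  proof -
    have "z - y = (1 - s) *\<^sub>R (z - x)" by (simp add: y_def algebra_simps)
    then show ?thesis using s by (simp add: dist_norm)
  qed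
  also have "\<dots> \<le> 1 * dist z x"
    using s by (intro mult_right_mono) auto
  finally have "y \<in> cball z (R + e)"
    using \<open>dist z x \<le> R + e\<close> by simp
  \<comment> \<open>The contraction towards \<open>x\<close> with factor \<open>s\<close> maps
    \<open>ball z r\<close> onto the ball of radius \<open>s * r\<close> around \<open>y\<close>,
    and it maps \<open>P\<close> into itself by convexity.\<close>
  moreover have "w \<in> P" if "w \<in> ball y \<rho>" for w
  proof -
    have "norm (w - y) < s * r"
      using that by (simp add: \<rho> s_def dist_norm norm_minus_commute)
    then have "norm ((w - y) /\<^sub>R s) < r"
      using s unfolding norm_scaleR by (simp add: field_simps)
    then have "z + (w - y) /\<^sub>R s \<in> ball z r"
      by (simp only: mem_ball dist_norm) simp
    then have "z + (w - y) /\<^sub>R s \<in> P"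
      using assms(2) by blast
    from convexD[OF \<open>convex P\<close> \<open>x \<in> P\<close> this, of "1 - s" s]
    have "(1 - s) *\<^sub>R x + s *\<^sub>R (z + (w - y) /\<^sub>R s) \<in> P"
      using s by simp
    also have "(1 - s) *\<^sub>R x + s *\<^sub>R (z + (w - y) /\<^sub>R s) = w"
      using s by (simp add: y_def algebra_simps)
    finally show ?thesis .
  qed
  moreover have "w \<notin> Q" if "w \<in> ball y \<rho>" for w
  proof
    assume "w \<in> Q"
    then have "e \<le> dist x w" using infdist_le[of w Q x] x by simp
    also have "\<dots> \<le> dist x y + dist y w" by (rule dist_triangle)
    also have "\<dots> < e" using \<open>dist x y \<le> e / 2\<close> that by (simp add: \<rho>)
    finally show False by simp
  qed
  ultimately show ?thesis by blast
qed

lemma limitin_hausdorff_of_separation: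
  fixes P :: "nat \<Rightarrow> 'a::euclidean_space set"
  assumes T: "region_separation T"
    and P: "range P \<subseteq> convex_regions" and Q: "Q \<in> convex_regions"
    and lim: "limitin T P Q sequentially"
  shows "limitin (Metric_space.mtopology regions hausdorff_dist) P Q sequentially"
proof -
  have Q': "Q \<in> regions" "open Q" "convex Q" "bounded Q" "Q \<noteq> {}"
    using Q by (auto simp: convex_regions_def regions_def)
  have P': "P k \<in> convex_regions" "P k \<in> regions" "convex (P k)" "P k \<noteq> {}" for k
    using P by (auto simp: convex_regions_def regions_def)
  have PR: "range P \<subseteq> regions" using P' by auto
  note inner = hausdorff1_limit_of_separation[OF T PR Q'(1) lim]
  obtain z r where r: "0 < r" "ball z (r + r) \<subseteq> Q"
  proof -
    obtain z where "z \<in> Q" using Q' by blast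
    then obtain e where "0 < e" "ball z e \<subseteq> Q" using openE[OF \<open>open Q\<close>] by blast
    then show thesis using that[of "e / 2" z] by simp
  qed
  then have "z \<in> Q" by auto
  obtain R where R: "0 < R" "Q \<subseteq> ball z R"
    using \<open>bounded Q\<close> by (metis bounded_subset_ballD)
  have "\<forall>\<^sub>F k in sequentially. hausdorff1 (P k) Q < e" if "0 < e" for e
  proof -
    define c where "c = e / 2"
    have "0 < c" using that by (simp add: c_def)
    define \<rho> where "\<rho> = min (c / 2) (c / (2 * (R + c)) * r)"
    have "0 < \<rho>" using \<open>0 < c\<close> R r by (simp add: \<rho>_def)
    \<comment> \<open>With half the radius, every ball of radius \<open>\<rho>\<close> centred in
      the compact ball contains one of finitely many test balls.\<close>
    obtain F where F: "finite F" "cball z (R + c) \<subseteq> (\<Union>x\<in>F. ball x (\<rho> / 2))"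
    proof -
      have "cball z (R + c) \<subseteq> (\<Union>x\<in>cball z (R + c). ball x (\<rho> / 2))"
        using \<open>0 < \<rho>\<close> by force
      then show thesis
        using that by (rule compactE_image[OF compact_cball open_ball])
    qed
    \<comment> \<open>These are the test balls to which the first separation condition applies. A
      test ball inside a ball that misses \<open>Q\<close> is among them.\<close>
    define F' where "F' = {x \<in> F. ball x (\<rho> / 2) \<inter> Q = {}}"
    have "\<forall>\<^sub>F k in sequentially. \<not> ball x (\<rho> / 2) \<subseteq> P k" if "x \<in> F'" for x
    proof -
      have "Q \<inter> ball x (\<rho> / 2) = {}" "ball x (\<rho> / 2) \<in> regions"
        using that \<open>0 < \<rho>\<close> by (auto simp: F'_def ball_region)
      then show ?thesis
        by (intro eventually_not_superset_if_region_separation[OF T lim Q'(1)])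
    qed
    then have "\<forall>\<^sub>F k in sequentially. \<forall>x\<in>F'. \<not> ball x (\<rho> / 2) \<subseteq> P k"
      using F by (intro eventually_ball_finite) (auto simp: F'_def)
    \<comment> \<open>The closeness of \<open>Q\<close> to \<open>P k\<close> up to \<open>r\<close>
      puts the fixed ball \<open>ball z r\<close> into \<open>P k\<close>.\<close>
    with inner[OF \<open>0 < r\<close>] show ?thesis
    proof eventually_elim
      case (elim k)
      have "ball z r \<subseteq> P k"
        by (rule ball_subset_if_hausdorff1_less[OF Q'(1) P'(1) elim(1) r(2)])
      have "infdist p Q \<le> c" if "p \<in> P k" for p
      proof (rule ccontr)
        assume "\<not> infdist p Q \<le> c"
        then have "c \<le> infdist p Q" by simp
        from convex_ball_outside[OF P'(3) \<open>ball z r \<subseteq> P k\<close> r(1) \<open>z \<in> Q\<close> R(2) that \<open>0 < c\<close> this \<rho>_def]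
        obtain y where y: "y \<in> cball z (R + c)" "ball y \<rho> \<subseteq> P k" "ball y \<rho> \<inter> Q = {}"
          by blast
        then obtain x where x: "x \<in> F" "dist x y < \<rho> / 2" using F by auto
        have "ball x (\<rho> / 2) \<subseteq> ball y \<rho>"
          using x(2) by (auto simp: subset_iff dist_commute intro: dist_triangle_half_l)
        then show False
          using y x elim(2) unfolding F'_def by blast
      qed
      then have "hausdorff1 (P k) Q \<le> c" by (intro hausdorff1_le P')
      then show ?case using that by (simp add: c_def)
    qed
  qed
  then show ?thesis
    using inner by (simp add: limitin_hausdorff_iff[OF PR Q'(1)] eventually_conj_iff)
qed

section \<open>Comparing metric topologies by sequences\<close>

text \<open>Closedness in a metric space is sequential. If convergence for \<open>d'\<close> implies
  convergence for \<open>d\<close> within \<open>C\<close>, a set that keeps its \<open>d\<close>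
  limits also keeps its \<open>d'\<close> limits.\<close>

lemma closedin_subtopology_if_sequential:
  assumes d: "Metric_space M d" and d': "Metric_space M d'" and "C \<subseteq> M"
    and lim: "\<And>f l. range f \<subseteq> C \<Longrightarrow> l \<in> C \<Longrightarrow>
      limitin (Metric_space.mtopology M d') f l sequentially \<Longrightarrow>
      limitin (Metric_space.mtopology M d) f l sequentially"
    and clos: "closedin (subtopology (Metric_space.mtopology M d) C) S"
  shows "closedin (subtopology (Metric_space.mtopology M d') C) S"
proof -
  interpret d: Submetric M d C
    by (simp add: Submetric.intro Submetric_axioms.intro d \<open>C \<subseteq> M\<close>)
  interpret d': Submetric M d' C
    by (simp add: Submetric.intro Submetric_axioms.intro d' \<open>C \<subseteq> M\<close>)
  have S: "S \<subseteq> C" "\<And>f l. range f \<subseteq> S \<Longrightarrow> limitin d.sub.mtopology f l sequentially \<Longrightarrow> l \<in> S"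
    using clos unfolding d.mtopology_submetric[symmetric] d.sub.metric_closedin_iff_sequentially_closed
    by blast+
  have "l \<in> S" if f: "range f \<subseteq> S" "limitin d'.sub.mtopology f l sequentially" for f l
  proof -
    have "range f \<subseteq> C" using f S by blast
    moreover have "l \<in> C" "limitin (Metric_space.mtopology M d') f l sequentially"
      using f(2) by (auto simp: d'.mtopology_submetric limitin_subtopology)
    ultimately have "limitin d.sub.mtopology f l sequentially"
      by (simp add: d.mtopology_submetric limitin_subtopology lim range_subsetD)
    then show ?thesis using S f by blast
  qed
  then show ?thesis
    unfolding d'.mtopology_submetric[symmetric] d'.sub.metric_closedin_iff_sequentially_closed
    using S by blast
qed

lemma topology_eq_if_closedin_iff:
  assumes "\<And>S. closedin X S \<longleftrightarrow> closedin Y S"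
  shows "X = Y"
proof -
  have "topspace X = topspace Y"
    using assms closedin_topspace closedin_subset by (metis subset_antisym)
  then show ?thesis
    by (simp add: topology_eq openin_closedin_eq assms)
qed

theorem theorem9:
  fixes \<mu> :: "(real ^ 'n) set \<Rightarrow> (real ^ 'n) set \<Rightarrow> real"
  assumes "CARD('n) \<ge> 2"
    and "Metric_space regions \<mu>"
    and "well_behaved (Metric_space.mtopology regions \<mu>)"
  shows "subtopology (Metric_space.mtopology regions \<mu>) convex_regions =
         subtopology (Metric_space.mtopology regions hausdorff_dist) convex_regions"
proof -
  have sub: "convex_regions \<subseteq> (regions :: (real ^ 'n) set set)"
    by (auto simp: convex_regions_def)
  have wb: "supports_continuous_morphing (Metric_space.mtopology regions \<mu>)"
    "region_separation (Metric_space.mtopology regions \<mu>)"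
    using assms(3) by (auto simp: well_behaved_def)
  show ?thesis
  proof (rule topology_eq_if_closedin_iff, rule iffI)
    fix S :: "(real ^ 'n) set set"
    \<comment> \<open>Closed sets pass from \<open>\<mu>\<close> to the Hausdorff metric because
      Hausdorff convergence implies convergence for \<open>\<mu>\<close>; the other inclusion uses
      the converse implication.\<close>
    show "closedin (subtopology (Metric_space.mtopology regions hausdorff_dist) convex_regions) S"
      if "closedin (subtopology (Metric_space.mtopology regions \<mu>) convex_regions) S"
      by (rule closedin_subtopology_if_sequential[OF assms(2) Metric_space_hausdorff_dist sub _ that])
        (rule limitin_morphing_of_limitin_hausdorff[OF wb(1)])
    show "closedin (subtopology (Metric_space.mtopology regions \<mu>) convex_regions) S"
      if "closedin (subtopology (Metric_space.mtopology regions hausdorff_dist) convex_regions) S"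
      by (rule closedin_subtopology_if_sequential[OF Metric_space_hausdorff_dist assms(2) sub _ that])
        (rule limitin_hausdorff_of_separation[OF wb(2)])
  qed
qed

end
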